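(* Let $a\in\mathbb{R}$, $f \colon [a,\infty) \to \mathbb{R}$, $t_0 \in [a,\infty)$ and $\alpha \in (0,1)$. The conformable derivative $T^{\alpha}_a f(t_0)$ with lower terminal $a$ exists if and only if $f$ has a first derivative $f'(t_0)$ at $t_0$ (the right derivative if $t_0=a$), and in this case $$T^{\alpha}_a f(t_0) = (t_0 - a)^{1-\alpha} f'(t_0).$$
   Context: Let $a\in\mathbb{R}$ (the lower terminal) and $f\colon[a,\infty)\to\mathbb{R}$. The conformable derivative $T_a^\alpha f$ of order $\alpha\in(0,1]$ is defined as follows. (1) For $t\in(a,\infty)$: $T^{\alpha}_a f(t) = \lim_{\theta \to 0}\frac{f(t+\theta(t-a)^{1-\alpha}) - f(t)}{\theta}$, if the (finite) limit exists. (2) At $t=a$: $T_a^\alpha f(a)$ exists if and only if the right first derivative $f'(a)$ of $f$ at $a$ exists, and then $T_a^1 f(a)=f'(a)$, while $T_a^\alpha f(a)=0$ for $\alpha\in(0,1)$. For a real exponent $p>0$, $0^p=0$. *)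

theory Defs
  imports "HOL-Analysis.Analysis"
begin

text \<open>
  A function on \<open>[a, \<infinity>)\<close> is represented by a total function \<open>f\<close> whose values below \<open>a\<close> are
  irrelevant: first derivatives are taken \<open>at t within {a..}\<close>, which is the ordinary derivative
  for \<open>t > a\<close> and the right derivative for \<open>t = a\<close>, and the limit below, for \<open>t > a\<close>, only
  involves arguments of \<open>f\<close> near \<open>t\<close>. There is no conformable derivative at points \<open>t < a\<close>.
\<close>

definition has_conformable_derivative ::
  "real \<Rightarrow> real \<Rightarrow> (real \<Rightarrow> real) \<Rightarrow> real \<Rightarrow> real \<Rightarrow> bool" where
  "has_conformable_derivative a \<alpha> f t L \<longleftrightarrow>
     (t > a \<and> ((\<lambda>\<theta>. (f (t + \<theta> * (t - a) powr (1 - \<alpha>)) - f t) / \<theta>) \<longlongrightarrow> L) (at 0)) \<or>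
     (t = a \<and> (\<exists>D. (f has_real_derivative D) (at a within {a..}) \<and>
                    L = (if \<alpha> = 1 then D else 0)))"

definition conformable_differentiable ::
  "real \<Rightarrow> real \<Rightarrow> (real \<Rightarrow> real) \<Rightarrow> real \<Rightarrow> bool" where
  "conformable_differentiable a \<alpha> f t \<longleftrightarrow> (\<exists>L. has_conformable_derivative a \<alpha> f t L)"

definition conformable_deriv ::
  "real \<Rightarrow> real \<Rightarrow> (real \<Rightarrow> real) \<Rightarrow> real \<Rightarrow> real" where
  "conformable_deriv a \<alpha> f t = (THE L. has_conformable_derivative a \<alpha> f t L)"

lemma has_real_derivative_atLeast_unique:
  fixes f :: "real \<Rightarrow> real"
  assumes "(f has_real_derivative D) (at a within {a..})"
    and "(f has_real_derivative E) (at a within {a..})"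
  shows "D = E"
proof -
  have "at a within {a..} \<noteq> bot"
    by (simp add: at_within_Ici_at_right)
  then show ?thesis
    using assms unfolding has_field_derivative_iff by (rule tendsto_unique)
qed

lemma has_conformable_derivative_unique:
  assumes "has_conformable_derivative a \<alpha> f t L" "has_conformable_derivative a \<alpha> f t M"
  shows "L = M"
  using assms unfolding has_conformable_derivative_def
  by (auto dest: has_real_derivative_atLeast_unique intro: tendsto_unique[OF at_neq_bot])

lemma conformable_deriv_eqI:
  assumes "has_conformable_derivative a \<alpha> f t L"
  shows "conformable_deriv a \<alpha> f t = L"
  unfolding conformable_deriv_def
  using assms has_conformable_derivative_unique by blast

end

theory Submission
  imports Defs
begin

text \<open>
  For \<open>t > a\<close> the conformable derivative is the ordinary derivative at \<open>0\<close> of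
  \<open>\<theta> \<mapsto> f (t + \<theta> c)\<close> with \<open>c = (t - a) powr (1 - \<alpha>) > 0\<close>; this function arises
  from \<open>f\<close> by an invertible affine change of variable, so the chain rule applies in both
  directions.
\<close>

lemma has_real_derivative_affine_iff:
  fixes f :: "real \<Rightarrow> real"
  assumes "c \<noteq> 0"
  shows "((\<lambda>s. f (t + s * c)) has_real_derivative c * D) (at 0) \<longleftrightarrow>
         (f has_real_derivative D) (at t)"
proof
  assume "(f has_real_derivative D) (at t)"
  then have "(f has_real_derivative D) (at (t + 0 * c))" by simp
  moreover have "((\<lambda>s. t + s * c) has_real_derivative c) (at 0)"
    by (auto intro!: derivative_eq_intros)
  ultimately show "((\<lambda>s. f (t + s * c)) has_real_derivative c * D) (at 0)"
    using DERIV_chain2[of f D "\<lambda>s. t + s * c" 0 c UNIV] by (simp only: mult.commute[of c D])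
next
  assume "((\<lambda>s. f (t + s * c)) has_real_derivative c * D) (at 0)"
  \<comment> \<open>The point \<open>0\<close> is rewritten as the value at \<open>t\<close> of the
    inverse change of variable \<open>(x - t) / c\<close>, the form that the chain rule
    expects.\<close>
  then have "((\<lambda>s. f (t + s * c)) has_real_derivative c * D) (at ((t - t) / c))" by simp
  moreover have "((\<lambda>x. (x - t) / c) has_real_derivative 1 / c) (at t)"
    using assms by (auto intro!: derivative_eq_intros)
  ultimately have "((\<lambda>x. f (t + (x - t) / c * c)) has_real_derivative c * D * (1 / c)) (at t)"
    by (rule DERIV_chain2)
  then show "(f has_real_derivative D) (at t)"
    using assms by simp
qed

lemma has_conformable_derivative_iff_has_real_derivative:
  assumes "a < t"
  shows "has_conformable_derivative a \<alpha> f t ((t - a) powr (1 - \<alpha>) * D) \<longleftrightarrow>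
         (f has_real_derivative D) (at t within {a..})"
proof -
  have "at t within {a..} = at t"
    using assms by (intro at_within_interior) simp
  \<comment> \<open>At \<open>0\<close>, the difference quotient of
    \<open>\<theta> \<mapsto> f (t + \<theta> * c)\<close> is exactly the conformable
    quotient.\<close>
  then show ?thesis
    using assms has_real_derivative_affine_iff[of "(t - a) powr (1 - \<alpha>)" f t D]
    by (simp add: has_conformable_derivative_def DERIV_def)
qed

theorem corollary5p4:
  fixes a t0 \<alpha> :: real and f :: "real \<Rightarrow> real"
  assumes "t0 \<in> {a..}" and "\<alpha> \<in> {0<..<1}"
  shows "(conformable_differentiable a \<alpha> f t0 \<longleftrightarrow>
            (\<exists>D. (f has_real_derivative D) (at t0 within {a..}))) \<and>
         (\<forall>D. (f has_real_derivative D) (at t0 within {a..}) \<longrightarrow>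
            conformable_deriv a \<alpha> f t0 = (t0 - a) powr (1 - \<alpha>) * D)"
proof (cases "t0 = a")
  case True
  \<comment> \<open>Both sides of the formula vanish here: the left by the convention for \<alpha> <
    1 at the terminal, the right because \<open>0 powr (1 - \<alpha>) = 0\<close>.\<close>
  then show ?thesis
    using assms
    by (auto simp: conformable_differentiable_def has_conformable_derivative_def
        intro!: conformable_deriv_eqI)
next
  case False
  with assms have "a < t0" by simp
  note iff = has_conformable_derivative_iff_has_real_derivative[OF this, of \<alpha> f]
  \<comment> \<open>The factor is nonzero, so every candidate limit \<open>L\<close> has the shape
    covered by \<open>iff\<close>.\<close>
  have "\<exists>D. L = (t0 - a) powr (1 - \<alpha>) * D" for L
    using \<open>a < t0\<close> by (intro exI[of _ "L / (t0 - a) powr (1 - \<alpha>)"]) simp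
  then have "conformable_differentiable a \<alpha> f t0 \<longleftrightarrow>
      (\<exists>D. has_conformable_derivative a \<alpha> f t0 ((t0 - a) powr (1 - \<alpha>) * D))"
    unfolding conformable_differentiable_def by metis
  then show ?thesis
    using iff conformable_deriv_eqI by blast
qed

end
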